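(* Let $\varepsilon\in(0,1)$, and suppose the universe size $n$ and the stream length $m=\mathrm{poly}(n)$ are known. There exists a one-pass insertion-only streaming algorithm that makes $\widetilde{\mathcal{O}}\left(\frac{1}{\varepsilon^{\mathcal{O}(1)}}\sqrt{n}\right)$ internal state changes, uses $\mathcal{O}\left(\frac{\log^{\mathcal{O}(1)}(mn)}{\varepsilon^{\mathcal{O}(1)}}\right)$ bits of space, and outputs $\widehat{H}$ such that $\Pr\left[\left|\widehat{H}-H\right|\le\varepsilon\right]\ge\frac{2}{3}$, where $H$ is the Shannon entropy of the stream.
   Context: An insertion-only stream is a sequence of updates $u_1,\ldots,u_m$ with each $u_t\in[n]$; it defines the frequency vector $f\in\mathbb{R}^n$ by $f_i=|\{t:u_t=i\}|$. The Shannon entropy of the stream is $H=-\sum_{i=1}^n \frac{f_i}{m}\log\frac{f_i}{m}$ (with $0\log 0=0$). A streaming algorithm maintains a memory state $\sigma_t$ after processing update $t$ (with $\sigma_0=\emptyset$); the number of internal state changes is the number of $t$ with $\sigma_t\ne\sigma_{t-1}$. $\widetilde{\mathcal{O}}(\cdot)$ hides polylogarithmic factors. *)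

theory Defs
  imports "HOL-Probability.Probability"
begin

text \<open>
  A randomized one-pass streaming algorithm: its memory state is a bit string, and each update
  sends the current state to a random new state, using fresh coins. The transition does not
  depend on the position in the stream, so a clock would have to be stored in the state (and
  would be charged both as space and as state changes); likewise coins are only remembered if
  they are written to the state.
\<close>

record streaming_alg =
  step :: "bool list \<Rightarrow> nat \<Rightarrow> bool list pmf"
  answer :: "bool list \<Rightarrow> real"

primrec run_from :: "streaming_alg \<Rightarrow> bool list \<Rightarrow> nat list \<Rightarrow> bool list list pmf" where
  "run_from A s [] = return_pmf [s]"
| "run_from A s (u # us) =
     bind_pmf (step A s u) (\<lambda>s'. map_pmf ((#) s) (run_from A s' us))"

text \<open>The joint distribution of the list of all memory states, from the empty initial state
  to the state after the last update.\<close>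

definition run :: "streaming_alg \<Rightarrow> nat list \<Rightarrow> bool list list pmf" where
  "run A us = run_from A [] us"

definition state_changes :: "bool list list \<Rightarrow> nat" where
  "state_changes \<sigma> = card {t. 1 \<le> t \<and> t < length \<sigma> \<and> \<sigma> ! t \<noteq> \<sigma> ! (t - 1)}"

definition insertion_streams :: "nat \<Rightarrow> nat \<Rightarrow> nat list set" where
  "insertion_streams n m = {us. length us = m \<and> set us \<subseteq> {1..n}}"

definition frequency :: "nat list \<Rightarrow> nat \<Rightarrow> nat" where
  "frequency us i = card {t. t < length us \<and> us ! t = i}"

text \<open>Entropy in bits; a summand with frequency zero vanishes because its first factor does.\<close>

definition shannon_entropy :: "nat \<Rightarrow> nat list \<Rightarrow> real" where
  "shannon_entropy n us =
     - (\<Sum>i = 1..n. real (frequency us i) / real (length us)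
                    * log 2 (real (frequency us i) / real (length us)))"

end

theory Submission
  imports Defs
begin

text \<open>
  Polylogarithmically many state changes suffice. Write \<open>g f = f log (m / f)\<close>. If \<open>r\<close> is the number
  of occurrences of the item at a uniformly random position, from that position on, then
  \<open>g r - g (r - 1)\<close> has mean equal to the entropy and is bounded by \<open>O(log m)\<close>, so averaging
  polylogarithmically many independent copies gives additive error \<open>\<epsilon>\<close>. Each copy waits in an
  empty slot, samples each update with probability \<open>\<delta> / m\<close>, and then counts further occurrences
  with a capped Morris counter. The increment of \<open>g\<close> varies by \<open>O(1 / r)\<close> from \<open>r\<close> to \<open>r + 1\<close>, so a
  counter of small relative error biases the estimate only slightly. A slot moves only upwards,
  through at most as many values as the counter has, which bounds the state changes.
\<close>

subsection \<open>Chains, encodings and independent copies\<close>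

lemma expectation_bind_pmf:
  fixes h :: "'b \<Rightarrow> real"
  assumes "finite (set_pmf p)" "\<And>x. x \<in> set_pmf p \<Longrightarrow> finite (set_pmf (f x))"
  shows "measure_pmf.expectation (bind_pmf p f) h
    = measure_pmf.expectation p (\<lambda>x. measure_pmf.expectation (f x) h)"
  using assms by (simp add: pmf_expectation_bind[of "set_pmf p"] integral_measure_pmf[of "set_pmf p"])

lemma expectation_le:
  assumes "finite (set_pmf P)" "\<And>x. h x \<le> (c::real)"
  shows "measure_pmf.expectation P h \<le> c"
proof -
  have "measure_pmf.expectation P h \<le> measure_pmf.expectation P (\<lambda>_. c)"
    using assms by (intro integral_mono integrable_measure_pmf_finite) auto
  then show ?thesis by simp
qed

lemma expectation_bind_bernoulli:
  fixes h :: "'b \<Rightarrow> real"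
  assumes "0 \<le> p" "p \<le> 1" "\<And>b. finite (set_pmf (f b))"
  shows "measure_pmf.expectation (bind_pmf (bernoulli_pmf p) f) h
    = p * measure_pmf.expectation (f True) h + (1 - p) * measure_pmf.expectation (f False) h"
  using assms by (subst expectation_bind_pmf) auto

section \<open>Chains on abstract states and their encoding as bit strings\<close>

primrec final_state :: "('s \<Rightarrow> 'u \<Rightarrow> 's pmf) \<Rightarrow> 's \<Rightarrow> 'u list \<Rightarrow> 's pmf" where
  "final_state T s [] = return_pmf s"
| "final_state T s (u # us) = bind_pmf (T s u) (\<lambda>s'. final_state T s' us)"

lemma finite_final_state:
  assumes "\<And>s u. finite (set_pmf (T s u))"
  shows "finite (set_pmf (final_state T s us))"
  using assms by (induction us arbitrary: s) auto

lemma state_changes_singleton: "state_changes [s] = 0"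
  by (auto simp: state_changes_def intro!: card_eq_0_iff[THEN iffD2])

lemma state_changes_Cons:
  assumes "\<sigma> \<noteq> []"
  shows "state_changes (s # \<sigma>) = (if hd \<sigma> \<noteq> s then 1 else 0) + state_changes \<sigma>"
proof -
  let ?A = "{t. 1 \<le> t \<and> t < length \<sigma> \<and> \<sigma> ! t \<noteq> \<sigma> ! (t - 1)}"
  have "{t. 1 \<le> t \<and> t < length (s # \<sigma>) \<and> (s # \<sigma>) ! t \<noteq> (s # \<sigma>) ! (t - 1)}
      = (if hd \<sigma> \<noteq> s then {1} else {}) \<union> Suc ` ?A" (is "?L = ?R")
  proof (rule set_eqI)
    fix t show "t \<in> ?L \<longleftrightarrow> t \<in> ?R"
    proof (cases t)
      case (Suc r)
      then show ?thesis using assms by (cases r) (auto simp: hd_conv_nth image_iff)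
    qed auto
  qed
  moreover have "finite ?A" by simp
  ultimately show ?thesis
    unfolding state_changes_def by (auto simp: card_image card_insert_if)
qed

text \<open>There are \<open>2 ^ k\<close> strings of length exactly \<open>k\<close>, so those of
  length at most \<open>k\<close> can name all of \<open>S\<close>. The start state must receive the
  empty string because \<open>run\<close> starts there.\<close>

lemma ex_short_encoding:
  assumes "finite S" "card S \<le> 2 ^ k" "s0 \<in> S"
  shows "\<exists>enc :: 's \<Rightarrow> bool list. inj_on enc S \<and> enc s0 = [] \<and> (\<forall>s\<in>S. length (enc s) \<le> k)"
proof -
  let ?L = "{xs :: bool list. length xs \<le> k}"
  have L: "finite ?L" "card ?L \<ge> 2 ^ k"
  proof -
    show fin: "finite ?L"
      using finite_lists_length_le[of "UNIV :: bool set" k] by simp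
    have "card {xs :: bool list. length xs = k} = 2 ^ k"
      using card_lists_length_eq[of "UNIV :: bool set" k] by simp
    then show "card ?L \<ge> 2 ^ k"
      using card_mono[OF fin, of "{xs. length xs = k}"] by auto
  qed
  \<comment> \<open>Setting aside \<open>s0\<close> and \<open>[]\<close> removes one element on
    each side, so the remaining states still fit into the nonempty strings.\<close>
  have "card (S - {s0}) \<le> card (?L - {[]})"
    using assms L by (simp add: card_Diff_singleton)
  then obtain h where h: "inj_on h (S - {s0})" "h ` (S - {s0}) \<subseteq> ?L - {[]}"
    using card_le_inj[of "S - {s0}" "?L - {[]}"] assms(1) L(1) by auto
  define enc where "enc = h(s0 := [])"
  have "inj_on enc S"
  proof (rule inj_onI)
    fix x y assume "x \<in> S" "y \<in> S" "enc x = enc y"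
    moreover have "h z \<noteq> []" "[] \<noteq> h z" if "z \<in> S" "z \<noteq> s0" for z
      using h(2) that by force+
    ultimately show "x = y"
      using inj_onD[OF h(1), of x y] by (auto simp: enc_def split: if_splits)
  qed
  moreover have "\<forall>s\<in>S. length (enc s) \<le> k"
    using h(2) by (auto simp: enc_def)
  ultimately show ?thesis by (intro exI[of _ enc]) (auto simp: enc_def)
qed

text \<open>This allows the algorithm to be designed on abstract states. Each genuine move raises
  the rank by at least one and ranks stay below \<open>N\<close>, so no run can move more than
  \<open>N\<close> times; space is the length of the codes.\<close>

lemma streaming_alg_of_chain:
  fixes T :: "'s \<Rightarrow> nat \<Rightarrow> 's pmf" and rank :: "'s \<Rightarrow> nat" and out :: "'s \<Rightarrow> real"
  assumes S: "finite S" "card S \<le> 2 ^ k" "s0 \<in> S"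
    and closed: "\<And>s u s'. s \<in> S \<Longrightarrow> u \<in> U \<Longrightarrow> s' \<in> set_pmf (T s u) \<Longrightarrow> s' \<in> S"
    and rank: "\<And>s u s'. s \<in> S \<Longrightarrow> u \<in> U \<Longrightarrow> s' \<in> set_pmf (T s u) \<Longrightarrow> s' \<noteq> s \<Longrightarrow> rank s < rank s'"
    and bound: "\<And>s. s \<in> S \<Longrightarrow> rank s \<le> N"
  shows "\<exists>A. \<forall>us. set us \<subseteq> U \<longrightarrow>
     (\<forall>\<sigma>\<in>set_pmf (run A us). state_changes \<sigma> \<le> N \<and> (\<forall>s\<in>set \<sigma>. length s \<le> k)) \<and>
     map_pmf (\<lambda>\<sigma>. answer A (last \<sigma>)) (run A us) = map_pmf out (final_state T s0 us)"
proof -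
  obtain enc :: "'s \<Rightarrow> bool list" where enc: "inj_on enc S" "enc s0 = []" "\<forall>s\<in>S. length (enc s) \<le> k"
    using ex_short_encoding[OF S] by blast
  define dec where "dec = inv_into S enc"
  define A where "A = \<lparr>step = \<lambda>s u. map_pmf enc (T (dec s) u), answer = \<lambda>s. out (dec s)\<rparr>"
  have dec: "dec (enc s) = s" if "s \<in> S" for s
    using that enc by (simp add: dec_def)
  \<comment> \<open>The rank of the current state plus the changes still to come never exceeds
    \<open>N\<close>. The head of the run is tracked because it decides whether the next transition
    counts as a change.\<close>
  have run: "\<sigma> \<noteq> [] \<and> hd \<sigma> = enc s \<and> set \<sigma> \<subseteq> enc ` S \<and> rank s + state_changes \<sigma> \<le> N"
    if "\<sigma> \<in> set_pmf (run_from A (enc s) us)" "s \<in> S" "set us \<subseteq> U" for \<sigma> s us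
    using that
  proof (induction us arbitrary: s \<sigma>)
    case Nil
    then show ?case using bound by (auto simp: state_changes_singleton)
  next
    case (Cons u us)
    then obtain s' \<sigma>' where s': "s' \<in> set_pmf (T s u)"
      and \<sigma>': "\<sigma>' \<in> set_pmf (run_from A (enc s') us)" "\<sigma> = enc s # \<sigma>'"
      by (auto simp: A_def dec)
    have "s' \<in> S" using closed s' Cons.prems by auto
    with Cons.IH[OF \<sigma>'(1)] Cons.prems
    have "\<sigma>' \<noteq> []" "hd \<sigma>' = enc s'" "set \<sigma>' \<subseteq> enc ` S" "rank s' + state_changes \<sigma>' \<le> N"
      by auto
    moreover have "s' \<noteq> s \<Longrightarrow> rank s < rank s'" using rank s' Cons.prems by auto
    ultimately show ?case
      using \<sigma>'(2) Cons.prems by (cases "s' = s") (auto simp: state_changes_Cons)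
  qed
  have last: "map_pmf last (run_from A (enc s) us) = map_pmf enc (final_state T s us)"
    if "s \<in> S" "set us \<subseteq> U" for s us
    using that
  proof (induction us arbitrary: s)
    case (Cons u us)
    have "map_pmf last (run_from A (enc s) (u # us))
        = bind_pmf (T s u) (\<lambda>s'. map_pmf (\<lambda>\<sigma>. last (enc s # \<sigma>)) (run_from A (enc s') us))"
      using Cons.prems by (simp add: A_def dec map_bind_pmf bind_map_pmf pmf.map_comp o_def)
    also have "\<dots> = bind_pmf (T s u) (\<lambda>s'. map_pmf enc (final_state T s' us))"
    proof (rule bind_pmf_cong[OF refl])
      fix s' assume s': "s' \<in> set_pmf (T s u)"
      then have "s' \<in> S" using closed Cons.prems by auto
      then have "map_pmf (\<lambda>\<sigma>. last (enc s # \<sigma>)) (run_from A (enc s') us)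
          = map_pmf last (run_from A (enc s') us)"
        using run[of _ s' us] Cons.prems by (intro map_pmf_cong refl) auto
      then show "map_pmf (\<lambda>\<sigma>. last (enc s # \<sigma>)) (run_from A (enc s') us)
          = map_pmf enc (final_state T s' us)"
        using Cons \<open>s' \<in> S\<close> by simp
    qed
    finally show ?case by (simp add: map_bind_pmf)
  qed simp
  have reach: "set_pmf (final_state T s us) \<subseteq> S" if "s \<in> S" "set us \<subseteq> U" for s us
    using that closed by (induction us arbitrary: s) fastforce+
  show ?thesis
  proof (intro exI[of _ A] allI impI conjI)
    fix us assume us: "set us \<subseteq> U"
    show "\<forall>\<sigma>\<in>set_pmf (run A us). state_changes \<sigma> \<le> N \<and> (\<forall>s\<in>set \<sigma>. length s \<le> k)"
      using run[of _ s0 us] us S(3) enc by (fastforce simp: run_def)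
    have "map_pmf (\<lambda>\<sigma>. answer A (last \<sigma>)) (run A us)
        = map_pmf (answer A) (map_pmf last (run_from A (enc s0) us))"
      by (simp add: run_def enc pmf.map_comp o_def)
    also have "\<dots> = map_pmf (\<lambda>s. out (dec (enc s))) (final_state T s0 us)"
      using last[OF S(3) us] by (simp add: A_def pmf.map_comp o_def)
    also have "\<dots> = map_pmf out (final_state T s0 us)"
      using reach[OF S(3) us] dec by (intro map_pmf_cong refl) auto
    finally show "map_pmf (\<lambda>\<sigma>. answer A (last \<sigma>)) (run A us) = map_pmf out (final_state T s0 us)" .
  qed
qed

section \<open>Independent copies and concentration of their average\<close>

definition prod_step :: "nat \<Rightarrow> 's \<Rightarrow> ('s \<Rightarrow> 'u \<Rightarrow> 's pmf) \<Rightarrow> (nat \<Rightarrow> 's) \<Rightarrow> 'u \<Rightarrow> (nat \<Rightarrow> 's) pmf" where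
  "prod_step q d T f u = Pi_pmf {..<q} d (\<lambda>j. T (f j) u)"

text \<open>All copies read the same update but use fresh independent coins, so the product form
  survives each step. Coordinates from \<open>q\<close> on must hold \<open>d\<close>, the value
  that \<open>Pi_pmf\<close> puts there.\<close>

lemma final_state_prod_step:
  assumes "\<And>j. j \<ge> q \<Longrightarrow> f j = d"
  shows "final_state (prod_step q d T) f us = Pi_pmf {..<q} d (\<lambda>j. final_state T (f j) us)"
  using assms
proof (induction us arbitrary: f)
  case Nil
  have "(\<lambda>j. if j \<in> {..<q} then f j else d) = f" using Nil by (auto simp: fun_eq_iff)
  then show ?case by simp
next
  case (Cons u us)
  have "final_state (prod_step q d T) f (u # us)
      = bind_pmf (prod_step q d T f u) (\<lambda>g. Pi_pmf {..<q} d (\<lambda>j. final_state T (g j) us))"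
    unfolding final_state.simps
  proof (rule bind_pmf_cong[OF refl])
    fix g assume "g \<in> set_pmf (prod_step q d T f u)"
    then have "\<And>j. j \<ge> q \<Longrightarrow> g j = d"
      using set_Pi_pmf_subset[of "{..<q}" d "\<lambda>j. T (f j) u"] by (auto simp: prod_step_def)
    then show "final_state (prod_step q d T) g us = Pi_pmf {..<q} d (\<lambda>j. final_state T (g j) us)"
      by (rule Cons.IH)
  qed
  also have "\<dots> = Pi_pmf {..<q} d (\<lambda>j. final_state T (f j) (u # us))"
    by (simp add: prod_step_def Pi_pmf_bind[where d' = d])
  finally show ?case .
qed

text \<open>Induction on the number of copies: the newest copy is independent of the others and
  centred, so the cross term of the square vanishes.\<close>

lemma expectation_sum_Pi_pmf:
  fixes Y :: "'s \<Rightarrow> real"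
  assumes fin: "finite (set_pmf p)"
    and mean: "measure_pmf.expectation p Y = 0"
  shows "measure_pmf.expectation (Pi_pmf {..<q::nat} d (\<lambda>_. p)) (\<lambda>f. \<Sum>j<q. Y (f j)) = 0"
    and "measure_pmf.expectation (Pi_pmf {..<q} d (\<lambda>_. p)) (\<lambda>f. (\<Sum>j<q. Y (f j))\<^sup>2)
      = real q * measure_pmf.expectation p (\<lambda>y. (Y y)\<^sup>2)"
proof (induction q)
  case (Suc q)
  let ?P = "Pi_pmf {..<q} d (\<lambda>_. p)"
  have finP: "finite (set_pmf ?P)" 
    using fin by (intro finite_subset[OF set_Pi_pmf_subset'] finite_PiE_dflt) auto
  note int = integrable_measure_pmf_finite[OF fin] integrable_measure_pmf_finite[OF finP]
  \<comment> \<open>Conditioning on the newest copy, for an arbitrary \<open>g\<close>, serves both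
    the identity and the square.\<close>
  have E: "measure_pmf.expectation (Pi_pmf {..<Suc q} d (\<lambda>_. p)) (\<lambda>f. g (\<Sum>j<Suc q. Y (f j)))
     = measure_pmf.expectation p (\<lambda>y. measure_pmf.expectation ?P (\<lambda>f. g (Y y + (\<Sum>j<q. Y (f j)))))"
    for g :: "real \<Rightarrow> real"
  proof -
    have "(\<Sum>j<q. Y (if j = q then y else f j)) = (\<Sum>j<q. Y (f j))" for y f
      by (intro sum.cong) auto
    then show ?thesis
      using fin finP by (simp add: lessThan_Suc Pi_pmf_insert' expectation_bind_pmf fun_upd_def)
  qed
  { case 1
    have "measure_pmf.expectation ?P (\<lambda>f. Y y + (\<Sum>j<q. Y (f j))) = Y y" for y
      using Suc.IH(1) int by (subst Bochner_Integration.integral_add) auto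
    then show ?case
      using E[of "\<lambda>x. x"] mean by simp
  next
    case 2
    have "measure_pmf.expectation ?P (\<lambda>f. (Y y + (\<Sum>j<q. Y (f j)))\<^sup>2)
       = (Y y)\<^sup>2 + real q * measure_pmf.expectation p (\<lambda>y. (Y y)\<^sup>2)" for y
      by (simp add: power2_sum int Suc.IH)
    then show ?case
      using E[of "\<lambda>x. x\<^sup>2"] by (simp add: int algebra_simps) }
qed simp_all

text \<open>Chebyshev: the centred sum has second moment at most \<open>q V\<close>, so it reaches
  \<open>q \<eta>\<close> with probability at most \<open>V / (q \<eta>^2) \<le> 1/3\<close>. One
  \<open>\<eta>\<close> pays for this deviation, the other for the bias.\<close>

lemma Pi_pmf_mean_concentration:
  fixes Y :: "'s \<Rightarrow> real"
  assumes fin: "finite (set_pmf p)" and q: "q > 0" and \<eta>: "\<eta> > 0"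
    and bias: "\<bar>measure_pmf.expectation p Y - x\<bar> \<le> \<eta>"
    and second_moment: "measure_pmf.expectation p (\<lambda>y. (Y y)\<^sup>2) \<le> V"
    and large: "3 * V \<le> real q * \<eta>\<^sup>2"
  shows "measure_pmf.prob (Pi_pmf {..<q} d (\<lambda>_. p)) {f. \<bar>(\<Sum>j<q. Y (f j)) / real q - x\<bar> \<le> 2 * \<eta>} \<ge> 2 / 3"
proof -
  let ?P = "Pi_pmf {..<q} d (\<lambda>_. p)"
  define \<mu> where "\<mu> = measure_pmf.expectation p Y"
  define Z where "Z = (\<lambda>f. \<Sum>j<q. Y (f j) - \<mu>)"
  have finP: "finite (set_pmf ?P)" 
    using fin by (intro finite_subset[OF set_Pi_pmf_subset'] finite_PiE_dflt) auto
  note int = integrable_measure_pmf_finite[OF fin] integrable_measure_pmf_finite[OF finP]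
  have "measure_pmf.expectation p (\<lambda>y. (Y y - \<mu>)\<^sup>2) = measure_pmf.expectation p (\<lambda>y. (Y y)\<^sup>2) - \<mu>\<^sup>2"
    unfolding \<mu>_def using int by (intro measure_pmf.variance_eq) auto
  then have "measure_pmf.expectation p (\<lambda>y. (Y y - \<mu>)\<^sup>2) \<le> V" 
    using second_moment zero_le_power2[of \<mu>] by linarith
  moreover have "measure_pmf.expectation p (\<lambda>y. Y y - \<mu>) = 0"
    using int by (subst Bochner_Integration.integral_diff) (auto simp: \<mu>_def)
  ultimately have "measure_pmf.expectation ?P (\<lambda>f. (Z f)\<^sup>2) \<le> real q * V"
    unfolding Z_def by (subst expectation_sum_Pi_pmf(2)[OF fin]) (auto intro: mult_left_mono)
  moreover have "measure_pmf.prob ?P {f \<in> space ?P. \<bar>Z f\<bar> \<ge> real q * \<eta>}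
      \<le> measure_pmf.expectation ?P (\<lambda>f. (Z f)\<^sup>2) / (real q * \<eta>)\<^sup>2"
    using q \<eta> int by (intro measure_pmf.second_moment_method) auto
  ultimately have "measure_pmf.prob ?P {f. \<bar>Z f\<bar> \<ge> real q * \<eta>} \<le> real q * V / (real q * \<eta>)\<^sup>2"
    by (auto elim!: order_trans intro!: divide_right_mono)
  also have "\<dots> \<le> 1 / 3"
    using q \<eta> large by (simp add: field_simps power2_eq_square)
  finally have tail: "measure_pmf.prob ?P {f. \<bar>Z f\<bar> \<ge> real q * \<eta>} \<le> 1 / 3" .
  have "1 - measure_pmf.prob ?P {f. \<bar>Z f\<bar> \<ge> real q * \<eta>} = measure_pmf.prob ?P (- {f. \<bar>Z f\<bar> \<ge> real q * \<eta>})"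
    by (subst measure_pmf.prob_compl[symmetric]) (auto simp: Compl_eq_Diff_UNIV)
  also have "\<dots> \<le> measure_pmf.prob ?P {f. \<bar>(\<Sum>j<q. Y (f j)) / real q - x\<bar> \<le> 2 * \<eta>}"
  proof (intro measure_pmf.finite_measure_mono subsetI CollectI)
    fix f assume "f \<in> - {f. \<bar>Z f\<bar> \<ge> real q * \<eta>}"
    then have "\<bar>Z f\<bar> < real q * \<eta>" by auto
    moreover have "Z f = real q * ((\<Sum>j<q. Y (f j)) / real q - \<mu>)"
      using q by (simp add: Z_def sum_subtractf field_simps)
    ultimately have "\<bar>(\<Sum>j<q. Y (f j)) / real q - \<mu>\<bar> < \<eta>"
      using q by (simp add: abs_mult)
    then show "\<bar>(\<Sum>j<q. Y (f j)) / real q - x\<bar> \<le> 2 * \<eta>"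
      using bias unfolding \<mu>_def by linarith
  qed simp
  finally show ?thesis using tail by linarith
qed

subsection \<open>Morris counters and increments of the entropy function\<close>

text \<open>With \<open>g f = f log (m / f)\<close>, the increment \<open>g r - g (r - 1)\<close> is
  \<open>log 2 m - xlogx_diff r\<close>, so the stream length enters only as a constant.\<close>

definition xlogx_diff :: "nat \<Rightarrow> real" where
  "xlogx_diff r = real r * log 2 (real r) - real (r - 1) * log 2 (real (r - 1))"

lemma ln_ratio_bounds:
  assumes "k \<ge> (1::nat)"
  shows "ln (real k + 1) - ln (real k) \<le> 1 / real k"
    and "1 / (real k + 1) \<le> ln (real k + 1) - ln (real k)"
proof -
  have "1 + 1 / real k = (real k + 1) / real k" using assms by (simp add: field_simps)
  then have "ln (real k + 1) - ln (real k) = ln (1 + 1 / real k)"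
    using assms by (simp add: ln_div)
  also have "\<dots> \<le> 1 / real k" using assms by (intro ln_add_one_self_le_self) auto
  finally show "ln (real k + 1) - ln (real k) \<le> 1 / real k" .
  have "ln (real k) - ln (real k + 1) = ln (real k / (real k + 1))"
    using assms by (simp add: ln_div)
  also have "\<dots> \<le> real k / (real k + 1) - 1" using assms by (intro ln_le_minus_one) auto
  also have "\<dots> = - (1 / (real k + 1))" by (simp add: field_simps)
  finally show "1 / (real k + 1) \<le> ln (real k + 1) - ln (real k)" by simp
qed

lemma inverse_ln_2_le: "x \<ge> 0 \<Longrightarrow> x / ln 2 \<le> 3 / 2 * (x::real)"
  using ln2_ge_two_thirds mult_left_mono[of "2/3" "ln 2" x] by (simp add: field_simps)

text \<open>This is the second difference of the convex function \<open>x log x\<close>. In natural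
  logarithms it lies between \<open>0\<close> and \<open>2 / k\<close>; passing to base 2 costs at
  most the factor \<open>3/2\<close>.\<close>

lemma xlogx_diff_Suc:
  assumes "k \<ge> 1"
  shows "xlogx_diff k \<le> xlogx_diff (Suc k)" "xlogx_diff (Suc k) - xlogx_diff k \<le> 3 / real k"
proof -
  \<comment> \<open>Splitting \<open>2 k ln k\<close> into
    \<open>(k + 1) ln k + (k - 1) ln k\<close> leaves two weighted logarithms of ratios, the first
    in \<open>[1, 1 + 1/k]\<close> and the second in \<open>[1 - 1/k, 1]\<close>.\<close>
  define d where "d = (real k + 1) * (ln (real k + 1) - ln (real k))
     - (real k - 1) * (ln (real k) - ln (real (k - 1)))"
  have eq: "xlogx_diff (Suc k) - xlogx_diff k = d / ln 2"
    using assms by (simp add: xlogx_diff_def log_def d_def field_simps of_nat_diff)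
  have up: "(real k + 1) * (ln (real k + 1) - ln (real k)) \<le> (real k + 1) * (1 / real k)"
    and lo: "(real k + 1) * (1 / (real k + 1)) \<le> (real k + 1) * (ln (real k + 1) - ln (real k))"
    using ln_ratio_bounds[OF assms] by (intro mult_left_mono; simp)+
  have "(real k - 1) * (1 / real k) \<le> (real k - 1) * (ln (real k) - ln (real (k - 1)))
    \<and> (real k - 1) * (ln (real k) - ln (real (k - 1))) \<le> 1"
  proof (cases "k = 1")
    case False
    then have "k - 1 \<ge> 1" and k: "real (k - 1) + 1 = real k"
      using assms by (auto simp: of_nat_diff)
    define y where "y = ln (real k) - ln (real (k - 1))"
    have "y \<le> 1 / (real k - 1)" "1 / real k \<le> y"
      using ln_ratio_bounds[OF \<open>k - 1 \<ge> 1\<close>] assms unfolding k y_def by (auto simp: of_nat_diff)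
    then have "(real k - 1) * (1 / real k) \<le> (real k - 1) * y"
      "(real k - 1) * y \<le> (real k - 1) * (1 / (real k - 1))"
      using assms by (intro mult_left_mono; simp)+
    then show ?thesis using False assms by (simp add: y_def)
  qed simp
  then have "0 \<le> d" "d \<le> 2 / real k"
    using up lo assms unfolding d_def by (auto simp: field_simps)
  then have "0 \<le> d / ln 2" "d / ln 2 \<le> 3 / 2 * (2 / real k)"
    using order_trans[OF inverse_ln_2_le, of d] by auto
  then show "xlogx_diff k \<le> xlogx_diff (Suc k)" "xlogx_diff (Suc k) - xlogx_diff k \<le> 3 / real k"
    using eq by auto
qed

lemma xlogx_diff_mono:
  assumes "1 \<le> r" "r \<le> s"
  shows "xlogx_diff r \<le> xlogx_diff s"
  using assms(2,1) by (induction s rule: dec_induct) (auto intro!: order_trans[OF _ xlogx_diff_Suc(1)])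

lemma xlogx_diff_increase:
  assumes "1 \<le> r" "r \<le> s"
  shows "xlogx_diff s - xlogx_diff r \<le> 3 * (real s - real r) / real r"
  using assms(2,1)
proof (induction s rule: dec_induct)
  case (step k)
  have "xlogx_diff (Suc k) - xlogx_diff k \<le> 3 / real k"
    using step by (intro xlogx_diff_Suc) auto
  also have "\<dots> \<le> 3 / real r" using step by (intro divide_left_mono) auto
  finally show ?case using step by (simp add: field_simps)
qed simp

text \<open>The value at \<open>1\<close> is \<open>0\<close>, and the rest is monotonicity. Above,
  \<open>xlogx_diff r\<close> is \<open>log 2 r\<close> plus
  \<open>(r - 1) log 2 (r / (r - 1))\<close>, and the latter is at most
  \<open>1 / ln 2 \<le> 3/2\<close>.\<close>

lemma xlogx_diff_bounds:
  assumes "1 \<le> r" "r \<le> m"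
  shows "0 \<le> xlogx_diff r" "xlogx_diff r \<le> 2 + log 2 (real m)"
proof -
  show "0 \<le> xlogx_diff r" using xlogx_diff_mono[of 1 r] assms by (simp add: xlogx_diff_def)
  have "xlogx_diff r \<le> 2 + log 2 (real r)"
  proof (cases "r = 1")
    case False
    then have "r - 1 \<ge> 1" and r: "real (r - 1) + 1 = real r" and r2: "real (r - 1) = real r - 1"
      using assms by (auto simp: of_nat_diff)
    have "(real r - 1) * (ln (real r) - ln (real (r - 1))) \<le> 1"
      using ln_ratio_bounds(1)[OF \<open>r - 1 \<ge> 1\<close>] \<open>r - 1 \<ge> 1\<close> unfolding r by (auto simp: r2 field_simps)
    then have "(real r - 1) * (ln (real r) - ln (real (r - 1))) / ln 2 \<le> 1 / ln 2"
      by (intro divide_right_mono) auto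
    moreover have "xlogx_diff r = log 2 (real r) + (real r - 1) * (ln (real r) - ln (real (r - 1))) / ln 2"
      unfolding xlogx_diff_def log_def r2 by (simp add: field_simps)
    ultimately show ?thesis using inverse_ln_2_le[of 1] by simp
  qed (simp add: xlogx_diff_def)
  also have "\<dots> \<le> 2 + log 2 (real m)" using assms by simp
  finally show "xlogx_diff r \<le> 2 + log 2 (real m)" .
qed

text \<open>A Lipschitz bound in terms of the relative error of the count, which is what a Morris
  counter controls.\<close>

lemma xlogx_diff_dist:
  assumes "1 \<le> r" "r \<le> m" "1 \<le> s" "s \<le> m"
  shows "\<bar>xlogx_diff s - xlogx_diff r\<bar> \<le> 3 * (2 + log 2 (real m)) * (\<bar>real s - real r\<bar> / real r)"
proof -
  define B where "B = 2 + log 2 (real m)"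
  have B: "B \<ge> 2" using assms by (simp add: B_def)
  \<comment> \<open>An overestimate is covered by the increment bound; an underestimate by at most a
    factor two costs another factor two. Below \<open>r / 2\<close> the relative error exceeds
    \<open>1/3\<close>, and the crude bound \<open>B\<close> on both values suffices.\<close>
  consider "r \<le> s" | "s < r" "r \<le> 2 * s" | "2 * s < r" by linarith
  then have "\<bar>xlogx_diff s - xlogx_diff r\<bar> \<le> 3 * B * (\<bar>real s - real r\<bar> / real r)"
  proof cases
    case 1
    then have "\<bar>xlogx_diff s - xlogx_diff r\<bar> \<le> 3 * (\<bar>real s - real r\<bar> / real r)"
      using xlogx_diff_increase[of r s] xlogx_diff_mono[of r s] assms by simp
    also have "\<dots> \<le> 3 * B * (\<bar>real s - real r\<bar> / real r)"
      using B by (intro mult_right_mono) auto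
    finally show ?thesis .
  next
    case 2
    then have "\<bar>xlogx_diff s - xlogx_diff r\<bar> \<le> 3 * (\<bar>real s - real r\<bar> / real s)"
      using xlogx_diff_increase[of s r] xlogx_diff_mono[of s r] assms by simp
    also have "\<dots> \<le> 3 * (2 * (\<bar>real s - real r\<bar> / real r))"
    proof -
      have "(real r - real s) * real r \<le> (real r - real s) * (2 * real s)"
        using 2 by (intro mult_left_mono) auto
      then show ?thesis using assms 2 by (simp add: field_simps)
    qed
    also have "\<dots> = 3 * 2 * (\<bar>real s - real r\<bar> / real r)" by simp
    also have "\<dots> \<le> 3 * B * (\<bar>real s - real r\<bar> / real r)"
      using B by (intro mult_right_mono) auto
    finally show ?thesis .
  next
    case 3
    have "\<bar>xlogx_diff s - xlogx_diff r\<bar> \<le> B"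
      using xlogx_diff_bounds[of s m] xlogx_diff_bounds[of r m] assms by (simp add: B_def)
    also have "B = 3 * B * (1 / 3)" by simp
    also have "\<dots> \<le> 3 * B * (\<bar>real s - real r\<bar> / real r)"
      using 3 B assms by (intro mult_left_mono) (auto simp: field_simps)
    finally show ?thesis .
  qed
  then show ?thesis by (simp add: B_def)
qed

section \<open>Morris counters: moments, capping and rounding\<close>

definition morris_step :: "real \<Rightarrow> nat \<Rightarrow> nat pmf" where
  "morris_step a k = map_pmf (\<lambda>b. if b then Suc k else k) (bernoulli_pmf (1 / (1 + a) ^ k))"

primrec morris :: "real \<Rightarrow> nat \<Rightarrow> nat \<Rightarrow> nat pmf" where
  "morris a 0 k = return_pmf k"
| "morris a (Suc r) k = bind_pmf (morris_step a k) (morris a r)"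

text \<open>The cap makes the number of increments small surely rather than with high probability.\<close>

definition capped_morris_step :: "nat \<Rightarrow> real \<Rightarrow> nat \<Rightarrow> nat pmf" where
  "capped_morris_step M a k = (if k < M then morris_step a k else return_pmf k)"

primrec capped_morris :: "nat \<Rightarrow> real \<Rightarrow> nat \<Rightarrow> nat \<Rightarrow> nat pmf" where
  "capped_morris M a 0 k = return_pmf k"
| "capped_morris M a (Suc r) k = bind_pmf (capped_morris_step M a k) (capped_morris M a r)"

text \<open>The offset \<open>1\<close> counts the occurrence at which the counter is created.\<close>

definition morris_estimate :: "real \<Rightarrow> nat \<Rightarrow> real" where
  "morris_estimate a k = 1 + ((1 + a) ^ k - 1) / a"

lemma set_morris_step: "set_pmf (morris_step a k) \<subseteq> {k, Suc k}"
  by (auto simp: morris_step_def)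

lemma finite_morris [simp]: "finite (set_pmf (morris a r k))"
  by (induction r arbitrary: k) (auto intro: finite_subset[OF set_morris_step])

lemma expectation_morris_Suc:
  assumes "a > 0"
  shows "measure_pmf.expectation (morris a (Suc r) k) h
    = 1 / (1 + a) ^ k * measure_pmf.expectation (morris a r (Suc k)) h
      + (1 - 1 / (1 + a) ^ k) * measure_pmf.expectation (morris a r k) (h :: nat \<Rightarrow> real)"
  using assms by (simp add: morris_step_def bind_map_pmf expectation_bind_bernoulli)

text \<open>A step from \<open>j\<close> adds \<open>a (1 + a)^j\<close> with probability
  \<open>(1 + a)^(-j)\<close>, hence \<open>a\<close> in mean; the square gains
  \<open>(2 a + a^2) (1 + a)^j\<close> in mean. The start \<open>k\<close> is arbitrary because the
  induction splits off the first step.\<close>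

lemma morris_moments:
  assumes a: "a > 0"
  shows "measure_pmf.expectation (morris a r k) (\<lambda>j. (1 + a) ^ j) = (1 + a) ^ k + a * real r"
    and "measure_pmf.expectation (morris a r k) (\<lambda>j. ((1 + a) ^ j)\<^sup>2)
      = ((1 + a) ^ k)\<^sup>2 + (2 * a + a\<^sup>2) * (real r * (1 + a) ^ k + a * (real r * (real r - 1) / 2))"
proof (induction r arbitrary: k)
  case (Suc r)
  have nz: "(1 + a) ^ k \<noteq> 0" for k using a by simp
  { case 1
    show ?case
      unfolding expectation_morris_Suc[OF a] Suc.IH using nz
      by (simp add: field_simps)
  next
    case 2
    show ?case
      unfolding expectation_morris_Suc[OF a] Suc.IH using nz
      by (simp add: field_simps power2_eq_square) }
qed simp_all

lemma morris_estimate_variance: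
  assumes a: "a > 0"
  shows "measure_pmf.expectation (morris a r 0) (\<lambda>j. (morris_estimate a j - real (Suc r))\<^sup>2)
    \<le> a * (real (Suc r))\<^sup>2"
proof -
  note int = integrable_measure_pmf_finite[OF finite_morris[of a r 0]]
  \<comment> \<open>The error equals \<open>((1 + a)^j - (1 + a r)) / a\<close>, so the two moments
    determine its mean square exactly.\<close>
  have "(morris_estimate a j - real (Suc r))\<^sup>2
      = (((1 + a) ^ j)\<^sup>2 - 2 * (1 + a * real r) * (1 + a) ^ j + (1 + a * real r)\<^sup>2) / a\<^sup>2" for j
    using a by (simp add: morris_estimate_def field_simps power2_eq_square)
  then have "measure_pmf.expectation (morris a r 0) (\<lambda>j. (morris_estimate a j - real (Suc r))\<^sup>2)
      = (measure_pmf.expectation (morris a r 0) (\<lambda>j. ((1 + a) ^ j)\<^sup>2)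
        - 2 * (1 + a * real r) * measure_pmf.expectation (morris a r 0) (\<lambda>j. (1 + a) ^ j)
        + (1 + a * real r)\<^sup>2) / a\<^sup>2"
    by (simp add: int)
  also have "\<dots> = a * (real r * (real r - 1) / 2)"
    unfolding morris_moments[OF a] using a by (simp add: field_simps power2_eq_square)
  also have "\<dots> \<le> a * (real (Suc r))\<^sup>2"
    using a by (intro mult_left_mono) (auto simp: field_simps power2_eq_square)
  finally show ?thesis .
qed

text \<open>The uncapped counter moves up by single steps and never down, so freezing it at
  \<open>M\<close> is the same as truncating its final value. Its moments thus remain
  usable.\<close>

lemma capped_morris_eq:
  "capped_morris M a r (min M k) = map_pmf (min M) (morris a r k)"
proof (induction r arbitrary: k)
  case (Suc r)
  have "map_pmf (min M) (morris a (Suc r) k)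
      = bind_pmf (morris_step a k) (\<lambda>j. capped_morris M a r (min M j))"
    by (simp add: map_bind_pmf Suc.IH)
  also have "\<dots> = bind_pmf (capped_morris_step M a (min M k)) (capped_morris M a r)"
  proof (cases "k < M")
    case True
    have "bind_pmf (morris_step a k) (\<lambda>j. capped_morris M a r (min M j))
        = bind_pmf (morris_step a k) (capped_morris M a r)"
    proof (rule bind_pmf_cong[OF refl])
      fix j assume "j \<in> set_pmf (morris_step a k)"
      then have "j = k \<or> j = Suc k" using set_morris_step by blast
      then have "min M j = j" using True by auto
      then show "capped_morris M a r (min M j) = capped_morris M a r j" by simp
    qed
    then show ?thesis using True by (simp add: capped_morris_step_def)
  next
    case False
    have "bind_pmf (morris_step a k) (\<lambda>j. capped_morris M a r (min M j))
        = bind_pmf (morris_step a k) (\<lambda>_. capped_morris M a r M)"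
    proof (rule bind_pmf_cong[OF refl])
      fix j assume "j \<in> set_pmf (morris_step a k)"
      then have "j = k \<or> j = Suc k" using set_morris_step by blast
      then have "min M j = M" using False by auto
      then show "capped_morris M a r (min M j) = capped_morris M a r M" by simp
    qed
    then show ?thesis using False by (simp add: capped_morris_step_def bind_return_pmf)
  qed
  finally show ?case by simp
qed simp

text \<open>Rounding provides the natural number that \<open>xlogx_diff\<close> expects. Clipping at
  \<open>m\<close> keeps the value in the range where increments are bounded, and later hides the
  cap of the counter.\<close>

definition count_estimate :: "real \<Rightarrow> nat \<Rightarrow> nat \<Rightarrow> nat" where
  "count_estimate a m k = nat (round (min (morris_estimate a k) (real m)))"

lemma morris_estimate_mono: "a > 0 \<Longrightarrow> j \<le> k \<Longrightarrow> morris_estimate a j \<le> morris_estimate a k"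
  by (simp add: morris_estimate_def divide_right_mono power_increasing)

lemma count_estimate_bounds:
  assumes "a > 0" "m \<ge> 1"
  shows "1 \<le> count_estimate a m k" "count_estimate a m k \<le> m"
proof -
  define x where "x = min (morris_estimate a k) (real m)"
  have x: "1 \<le> x" "x \<le> real m"
    using morris_estimate_mono[of a 0 k] assms by (auto simp: x_def morris_estimate_def)
  have "round (1::real) \<le> round x" "round x \<le> round (real m)"
    using x by (intro round_mono; simp)+
  then show "1 \<le> count_estimate a m k" "count_estimate a m k \<le> m"
    by (auto simp: count_estimate_def x_def[symmetric])
qed

text \<open>Clipping moves the estimate no farther from \<open>r \<le> m\<close>. If it is then
  within less than \<open>1/2\<close> of \<open>r\<close>, rounding is exact; otherwise the rounding
  error of at most \<open>1/2\<close> is no larger than the error already present.\<close>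

lemma count_estimate_error:
  assumes "a > 0" "1 \<le> r" "r \<le> m"
  shows "\<bar>real (count_estimate a m k) - real r\<bar> \<le> 2 * \<bar>morris_estimate a k - real r\<bar>"
proof -
  define x where "x = min (morris_estimate a k) (real m)"
  have "1 \<le> x"
    using morris_estimate_mono[of a 0 k] assms by (auto simp: x_def morris_estimate_def)
  then have "round (1::real) \<le> round x" by (intro round_mono)
  then have eq: "real (count_estimate a m k) = of_int (round x)"
    by (simp add: count_estimate_def x_def[symmetric])
  have x: "\<bar>x - real r\<bar> \<le> \<bar>morris_estimate a k - real r\<bar>"
    using assms by (auto simp: x_def min_def)
  have rd: "\<bar>of_int (round x) - x\<bar> \<le> 1 / 2" by (rule of_int_round_abs_le)
  have "\<bar>of_int (round x) - real r\<bar> \<le> 2 * \<bar>x - real r\<bar>"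
  proof (cases "\<bar>x - real r\<bar> < 1 / 2")
    case True
    then have "round x = int r" by (intro round_unique') (auto simp: abs_minus_commute)
    then show ?thesis by simp
  next
    case False
    have "\<bar>of_int (round x) - real r\<bar> \<le> \<bar>of_int (round x) - x\<bar> + \<bar>x - real r\<bar>"
      by (metis abs_triangle_ineq diff_add_cancel add_diff_eq)
    then show ?thesis using rd False by argo
  qed
  then show ?thesis using x unfolding eq by argo
qed

text \<open>With \<open>a = \<theta>^2\<close> the relative root mean square error of the counter is
  at most \<open>\<theta>\<close>, and the Lipschitz bound turns this into a bias of order
  \<open>B \<theta>\<close>.\<close>

lemma xlogx_diff_count_estimate_bias:
  assumes \<theta>: "\<theta> > 0" and a: "a = \<theta>\<^sup>2" and m: "Suc r \<le> m" and cap: "real m \<le> morris_estimate a M"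
  shows "\<bar>measure_pmf.expectation (capped_morris M a r 0) (\<lambda>k. xlogx_diff (count_estimate a m k))
      - xlogx_diff (Suc r)\<bar> \<le> 6 * (2 + log 2 (real m)) * \<theta>"
proof -
  note int = integrable_measure_pmf_finite[OF finite_morris[of a r 0]]
  define B where "B = 2 + log 2 (real m)"
  have B: "B \<ge> 2" using m by (simp add: B_def)
  have a0: "a > 0" using \<theta> a by simp
  define e where "e = (\<lambda>j. morris_estimate a j - real (Suc r))"
  define h where "h = (\<lambda>j. xlogx_diff (count_estimate a m j) - xlogx_diff (Suc r))"
  \<comment> \<open>From \<open>M\<close> on all estimates are at least \<open>m\<close> and are
    clipped to \<open>m\<close>, so truncation at \<open>M\<close> is invisible.\<close>
  have "count_estimate a m (min M j) = count_estimate a m j" for j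
    using cap morris_estimate_mono[OF a0, of M j]
    unfolding count_estimate_def
    by (intro arg_cong[where f = "\<lambda>x. nat (round x)"]) (cases "j \<le> M"; simp add: min_def)
  then have "measure_pmf.expectation (capped_morris M a r 0) (\<lambda>k. xlogx_diff (count_estimate a m k))
      = measure_pmf.expectation (morris a r 0) (\<lambda>k. xlogx_diff (count_estimate a m k))"
    using capped_morris_eq[of M a r 0] by simp
  then have "\<bar>measure_pmf.expectation (capped_morris M a r 0) (\<lambda>k. xlogx_diff (count_estimate a m k))
      - xlogx_diff (Suc r)\<bar> = \<bar>measure_pmf.expectation (morris a r 0) h\<bar>"
    by (simp add: h_def int)
  also have "\<dots> \<le> measure_pmf.expectation (morris a r 0) (\<lambda>j. \<bar>h j\<bar>)"
    by (rule integral_abs_bound)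
  also have "\<dots> \<le> measure_pmf.expectation (morris a r 0)
      (\<lambda>j. 3 * B * (\<theta> + (e j)\<^sup>2 / ((real (Suc r))\<^sup>2 * \<theta>)))"
  proof (rule integral_mono[OF int int])
    fix j
    define x where "x = \<bar>e j\<bar> / real (Suc r)"
    have "\<bar>h j\<bar> \<le> 3 * B * (\<bar>real (count_estimate a m j) - real (Suc r)\<bar> / real (Suc r))"
      unfolding h_def B_def using count_estimate_bounds[OF a0, of m j] m
      by (intro xlogx_diff_dist) auto
    also have "\<dots> \<le> 3 * B * (2 * \<bar>e j\<bar> / real (Suc r))"
      using count_estimate_error[OF a0, of "Suc r" m j] m B unfolding e_def
      by (intro mult_left_mono divide_right_mono) auto
    also have "\<dots> = 3 * B * (2 * x)" by (simp add: x_def)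
    also have "\<dots> \<le> 3 * B * (\<theta> + x\<^sup>2 / \<theta>)"
    proof (rule mult_left_mono)
      \<comment> \<open>The arithmetic-geometric mean inequality replaces the absolute error by its
        square, whose mean is known.\<close>
      have "0 \<le> (x - \<theta>)\<^sup>2" by simp
      then show "2 * x \<le> \<theta> + x\<^sup>2 / \<theta>"
        using \<theta> by (simp add: field_simps power2_eq_square)
    qed (use B in auto)
    also have "x\<^sup>2 / \<theta> = (e j)\<^sup>2 / ((real (Suc r))\<^sup>2 * \<theta>)"
      by (simp add: x_def power_divide)
    finally show "\<bar>h j\<bar> \<le> 3 * B * (\<theta> + (e j)\<^sup>2 / ((real (Suc r))\<^sup>2 * \<theta>))" .
  qed
  also have "\<dots> = 3 * B * (\<theta> + measure_pmf.expectation (morris a r 0) (\<lambda>j. (e j)\<^sup>2)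
      / ((real (Suc r))\<^sup>2 * \<theta>))"
    by (simp add: int)
  also have "\<dots> \<le> 3 * B * (\<theta> + a * (real (Suc r))\<^sup>2 / ((real (Suc r))\<^sup>2 * \<theta>))"
    using morris_estimate_variance[OF a0, of r] B \<theta> unfolding e_def
    by (intro mult_left_mono add_left_mono divide_right_mono) auto
  also have "\<dots> = 6 * B * \<theta>"
    using \<theta> by (simp add: a power2_eq_square)
  finally show ?thesis by (simp add: B_def)
qed

subsection \<open>Sampling slots\<close>

text \<open>A slot is \<open>None\<close> until it samples an item; \<open>Some (i, k)\<close> holds the sampled item and its Morris
  counter. Never replacing a sample removes the need for a clock; a sampling rate far below
  \<open>1 / m\<close> keeps the sampled position nearly uniform.\<close>

definition slot_step :: "nat \<Rightarrow> real \<Rightarrow> real \<Rightarrow> (nat \<times> nat) option \<Rightarrow> nat \<Rightarrow> (nat \<times> nat) option pmf" where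
  "slot_step M a p s u = (case s of
     None \<Rightarrow> map_pmf (\<lambda>b. if b then Some (u, 0) else None) (bernoulli_pmf p)
   | Some (i, k) \<Rightarrow> if u = i then map_pmf (\<lambda>k'. Some (i, k')) (capped_morris_step M a k)
       else return_pmf s)"

definition slot_rank :: "(nat \<times> nat) option \<Rightarrow> nat" where
  "slot_rank s = (case s of None \<Rightarrow> 0 | Some (i, k) \<Rightarrow> Suc k)"

text \<open>Each position is sampled with probability about \<open>\<delta> / m\<close>; dividing by
  \<open>\<delta>\<close> makes the mean approximately the average over all positions. An empty slot
  contributes \<open>0\<close>.\<close>

definition slot_value :: "real \<Rightarrow> nat \<Rightarrow> real \<Rightarrow> (nat \<times> nat) option \<Rightarrow> real" where
  "slot_value \<delta> m a s = (case s of None \<Rightarrow> 0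
     | Some (i, k) \<Rightarrow> (log 2 (real m) - xlogx_diff (count_estimate a m k)) / \<delta>)"

definition slots :: "nat \<Rightarrow> nat \<Rightarrow> (nat \<times> nat) option set" where
  "slots n M = insert None (Some ` ({1..n} \<times> {..M}))"

lemma set_capped_morris_step: "set_pmf (capped_morris_step M a k) \<subseteq> (if k < M then {k, Suc k} else {k})"
  using set_morris_step by (auto simp: capped_morris_step_def)

lemma finite_capped_morris_step [simp]: "finite (set_pmf (capped_morris_step M a k))"
  by (rule finite_subset[OF set_capped_morris_step]) simp

lemma finite_capped_morris [simp]: "finite (set_pmf (capped_morris M a r k))"
  by (induction r arbitrary: k) auto

lemma finite_slot_step: "finite (set_pmf (slot_step M a p s u))"
  by (auto simp: slot_step_def split: option.splits)

lemma finite_final_slot [simp]: "finite (set_pmf (final_state (slot_step M a p) s us))"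
  by (intro finite_final_state finite_slot_step)

lemma slot_step_closed:
  assumes "s \<in> slots n M" "u \<in> {1..n}" "s' \<in> set_pmf (slot_step M a p s u)"
  shows "s' \<in> slots n M" "s' \<noteq> s \<Longrightarrow> slot_rank s < slot_rank s'"
proof -
  have "s' \<in> slots n M \<and> (s' \<noteq> s \<longrightarrow> slot_rank s < slot_rank s')"
  proof (cases s)
    case None
    then show ?thesis
      using assms by (auto simp: slots_def slot_step_def slot_rank_def split: if_splits)
  next
    case (Some x)
    then obtain i k where s: "s = Some (i, k)" "i \<in> {1..n}" "k \<le> M"
      using assms(1) by (auto simp: slots_def)
    show ?thesis
    proof (cases "u = i")
      case True
      then obtain k' where k': "k' \<in> set_pmf (capped_morris_step M a k)" "s' = Some (i, k')"
        using assms(3) s by (auto simp: slot_step_def)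
      have "k' = k \<or> k' = Suc k \<and> k < M"
        using subsetD[OF set_capped_morris_step k'(1)] by (auto split: if_splits)
      then show ?thesis using s k'(2) by (auto simp: slots_def slot_rank_def)
    next
      case False
      then show ?thesis using assms(3,1) s by (simp add: slot_step_def)
    qed
  qed
  then show "s' \<in> slots n M" "s' \<noteq> s \<Longrightarrow> slot_rank s < slot_rank s'" by auto
qed

lemma slot_rank_le: "s \<in> slots n M \<Longrightarrow> slot_rank s \<le> Suc M"
  by (auto simp: slots_def slot_rank_def)

lemma card_slots: "finite (slots n M)" "card (slots n M) = Suc (n * Suc M)"
  by (auto simp: slots_def card_insert_if card_image)

text \<open>A filled slot ignores all other items, so its counter is a Morris counter run on the
  later occurrences of its own item.\<close>

lemma final_state_slot_Some:
  "final_state (slot_step M a p) (Some (i, k)) us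
    = map_pmf (\<lambda>k'. Some (i, k')) (capped_morris M a (count_list us i) k)"
  by (induction us arbitrary: k)
    (auto simp: slot_step_def bind_map_pmf map_bind_pmf bind_return_pmf)

lemma expectation_slot_None_Cons:
  assumes "0 \<le> p" "p \<le> 1"
  shows "measure_pmf.expectation (final_state (slot_step M a p) None (u # us)) h
    = p * measure_pmf.expectation (final_state (slot_step M a p) (Some (u, 0)) us) h
     + (1 - p) * measure_pmf.expectation (final_state (slot_step M a p) None us) (h :: _ \<Rightarrow> real)"
proof -
  have "final_state (slot_step M a p) None (u # us)
    = bind_pmf (bernoulli_pmf p) (\<lambda>b. final_state (slot_step M a p) (if b then Some (u, 0) else None) us)"
    by (simp add: slot_step_def bind_map_pmf)
  then show ?thesis using assms by (simp only:) (subst expectation_bind_bernoulli, auto)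
qed

text \<open>A sampled position sees only the occurrences of its item from there on. Summing over all
  positions the increments of \<open>f \<mapsto> f log (m / f)\<close> at these suffix counts telescopes, for each
  item, to \<open>f log (m / f)\<close> at its full frequency.\<close>

primrec suffix_entropy :: "nat \<Rightarrow> nat list \<Rightarrow> real" where
  "suffix_entropy m [] = 0"
| "suffix_entropy m (u # us) = log 2 (real m) - xlogx_diff (Suc (count_list us u)) + suffix_entropy m us"

lemma suffix_entropy_eq:
  assumes "set us \<subseteq> {1..n}"
  shows "suffix_entropy m us
    = (\<Sum>i = 1..n. real (count_list us i) * (log 2 (real m) - log 2 (real (count_list us i))))"
  using assms
proof (induction us)
  case (Cons u us)
  let ?G = "\<lambda>f. real f * (log 2 (real m) - log 2 (real f))"
  have u: "u \<in> {1..n}" using Cons.prems by simp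
  \<comment> \<open>Prepending \<open>u\<close> changes only the summand of \<open>u\<close>, and by
    exactly one increment.\<close>
  have "(\<Sum>i = 1..n. ?G (count_list (u # us) i))
      = ?G (Suc (count_list us u)) + (\<Sum>i \<in> {1..n} - {u}. ?G (count_list us i))"
    using u by (subst sum.remove[of _ u]) (auto intro!: sum.cong)
  moreover have "(\<Sum>i = 1..n. ?G (count_list us i))
      = ?G (count_list us u) + (\<Sum>i \<in> {1..n} - {u}. ?G (count_list us i))"
    using u by (subst sum.remove[of _ u]) auto
  moreover have "?G (Suc f) = ?G f + (log 2 (real m) - xlogx_diff (Suc f))" for f
    by (simp add: xlogx_diff_def algebra_simps)
  ultimately show ?case using Cons by simp
qed simp

lemma frequency_eq_count_list: "frequency us i = count_list us i"
  unfolding frequency_def count_list_eq_length_filter length_filter_conv_card by metis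

lemma shannon_entropy_eq_suffix_entropy:
  assumes "us \<in> insertion_streams n m" "m \<ge> 1"
  shows "shannon_entropy n us = suffix_entropy m us / real m"
proof -
  have us: "length us = m" "set us \<subseteq> {1..n}" using assms by (auto simp: insertion_streams_def)
  have "- (real f / real m * log 2 (real f / real m)) = real f * (log 2 (real m) - log 2 (real f)) / real m" for f
    using assms by (cases "f = 0") (auto simp: log_divide field_simps)
  then show ?thesis
    unfolding shannon_entropy_def suffix_entropy_eq[OF us(2)] us(1)
    by (simp add: frequency_eq_count_list sum_divide_distrib sum_negf[symmetric] del: sum_negf)
qed

text \<open>\<open>\<delta>\<close> bounds the probability that a slot is filled within
  \<open>m\<close> updates, \<open>\<theta>\<close> is the relative accuracy of its counter, and the
  last assumption says that the capped counter can still represent \<open>m\<close>.\<close>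

locale slot_chain =
  fixes m M :: nat and \<delta> \<theta> :: real
  assumes m: "m \<ge> 1" and \<delta>: "0 < \<delta>" "\<delta> \<le> 1" and \<theta>: "\<theta> > 0"
    and cap: "real m \<le> morris_estimate (\<theta>\<^sup>2) M"
begin

definition "B = 2 + log 2 (real m)"
definition "p = \<delta> / real m"

abbreviation "slot_final \<equiv> final_state (slot_step M (\<theta>\<^sup>2) p)"
abbreviation "val \<equiv> slot_value \<delta> m (\<theta>\<^sup>2)"

lemma B_ge: "B \<ge> 2" using m by (simp add: B_def)

lemma p_bounds: "0 \<le> p" "p \<le> 1"
  using m \<delta> by (auto simp: p_def field_simps)

lemma increment_bound:
  assumes "1 \<le> r" "r \<le> m"
  shows "\<bar>log 2 (real m) - xlogx_diff r\<bar> \<le> B"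
proof -
  have "0 \<le> log 2 (real m)" using m by simp
  then show ?thesis using xlogx_diff_bounds[OF assms] by (simp add: B_def)
qed

section \<open>Mean and second moment of a single slot\<close>

lemma val_bound: "\<bar>val s\<bar> \<le> B / \<delta>"
proof (cases s)
  case None
  then show ?thesis using B_ge \<delta> by (simp add: slot_value_def)
next
  case (Some x)
  then show ?thesis
    using increment_bound[OF count_estimate_bounds, of "\<theta>\<^sup>2" "snd x"] \<theta> m \<delta>
    by (simp add: slot_value_def case_prod_beta abs_divide divide_right_mono)
qed

text \<open>Each position is sampled with probability at most \<open>\<delta> / m\<close> and then
  contributes at most \<open>(B / \<delta>)^2\<close>. Over \<open>m\<close> positions this gives
  \<open>B^2 / \<delta>\<close>, better than the worst case by a factor
  \<open>\<delta>\<close>.\<close>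

lemma slot_second_moment:
  "measure_pmf.expectation (slot_final None us) (\<lambda>s. (val s)\<^sup>2) \<le> real (length us) * (B\<^sup>2 / \<delta> / real m)"
proof (induction us)
  case (Cons u us)
  let ?E = "\<lambda>s. measure_pmf.expectation (slot_final s us) (\<lambda>s. (val s)\<^sup>2)"
  have sq: "(val s)\<^sup>2 \<le> (B / \<delta>)\<^sup>2" for s
    using power_mono[OF val_bound[of s], of 2] by simp
  have "measure_pmf.expectation (slot_final None (u # us)) (\<lambda>s. (val s)\<^sup>2)
      = p * ?E (Some (u, 0)) + (1 - p) * ?E None"
    by (rule expectation_slot_None_Cons[OF p_bounds])
  also have "\<dots> \<le> p * (B / \<delta>)\<^sup>2 + 1 * ?E None"
    using p_bounds sq
    by (intro add_mono mult_left_mono mult_right_mono expectation_le Bochner_Integration.integral_nonneg) auto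
  also have "p * (B / \<delta>)\<^sup>2 = B\<^sup>2 / \<delta> / real m"
    using \<delta> by (simp add: p_def power2_eq_square)
  finally have "measure_pmf.expectation (slot_final None (u # us)) (\<lambda>s. (val s)\<^sup>2)
      \<le> B\<^sup>2 / \<delta> / real m + ?E None" by (simp only: mult_1)
  moreover have "real (length (u # us)) * (B\<^sup>2 / \<delta> / real m)
      = B\<^sup>2 / \<delta> / real m + real (length us) * (B\<^sup>2 / \<delta> / real m)"
    by (simp only: length_Cons of_nat_Suc distrib_right mult_1)
  ultimately show ?case using Cons.IH by linarith
qed (simp add: slot_value_def)

text \<open>Induction from the end of the stream. A position adds two errors: the bias of its
  counter, and the contribution of later positions that is lost when the slot is filled
  here.\<close>

lemma slot_mean:
  assumes "length us \<le> m"
  shows "\<bar>measure_pmf.expectation (slot_final None us) val - suffix_entropy m us / real m\<bar>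
      \<le> real (length us) * ((6 * B * \<theta> + \<delta> * B) / real m)"
  using assms
proof (induction us)
  case (Cons u us)
  note int = integrable_measure_pmf_finite[OF finite_capped_morris[of M "\<theta>\<^sup>2" _ 0]]
  let ?E = "\<lambda>s. measure_pmf.expectation (slot_final s us) val"
  define r where "r = count_list us u"
  define D where "D = measure_pmf.expectation (capped_morris M (\<theta>\<^sup>2) r 0)
    (\<lambda>k. xlogx_diff (count_estimate (\<theta>\<^sup>2) m k))"
  have r: "Suc r \<le> m" using count_le_length[of us u] Cons.prems by (simp add: r_def)
  have "?E (Some (u, 0)) = (log 2 (real m) - D) / \<delta>"
    by (simp add: final_state_slot_Some slot_value_def D_def r_def int)
  then have "p * ?E (Some (u, 0)) = (log 2 (real m) - D) / real m"
    using \<delta> by (simp add: p_def)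
  then have E: "measure_pmf.expectation (slot_final None (u # us)) val
      = (log 2 (real m) - D) / real m + ?E None - p * ?E None"
    unfolding expectation_slot_None_Cons[OF p_bounds] by (simp add: left_diff_distrib)
  have "\<bar>D - xlogx_diff (Suc r)\<bar> \<le> 6 * B * \<theta>"
    unfolding D_def B_def using \<theta> r cap by (intro xlogx_diff_count_estimate_bias) auto
  then have bias: "\<bar>(D - xlogx_diff (Suc r)) / real m\<bar> \<le> 6 * B * \<theta> / real m"
    by (simp add: abs_divide divide_right_mono)
  have "\<bar>?E None\<bar> \<le> B"
  proof -
    text \<open>A slot is filled with probability at most \<open>\<delta>\<close>, so its mean is small although its
      values are of order \<open>B / \<delta>\<close>.\<close>
    have "\<bar>measure_pmf.expectation (slot_final None vs) val\<bar> \<le> real (length vs) * (B / real m)" for vs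
    proof (induction vs)
      case (Cons v vs)
      have "\<bar>measure_pmf.expectation (slot_final (Some (v, 0)) vs) val\<bar>
          \<le> measure_pmf.expectation (slot_final (Some (v, 0)) vs) (\<lambda>s. \<bar>val s\<bar>)"
        by (rule integral_abs_bound)
      also have "\<dots> \<le> B / \<delta>" by (intro expectation_le val_bound) auto
      finally have "p * \<bar>measure_pmf.expectation (slot_final (Some (v, 0)) vs) val\<bar> \<le> p * (B / \<delta>)"
        using p_bounds by (intro mult_left_mono) auto
      moreover have "p * (B / \<delta>) = B / real m" using \<delta> by (simp add: p_def)
      moreover have "(1 - p) * \<bar>measure_pmf.expectation (slot_final None vs) val\<bar>
          \<le> 1 * \<bar>measure_pmf.expectation (slot_final None vs) val\<bar>"
        using p_bounds by (intro mult_right_mono) auto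
      moreover have "\<bar>measure_pmf.expectation (slot_final None (v # vs)) val\<bar>
          \<le> p * \<bar>measure_pmf.expectation (slot_final (Some (v, 0)) vs) val\<bar>
            + (1 - p) * \<bar>measure_pmf.expectation (slot_final None vs) val\<bar>"
        unfolding expectation_slot_None_Cons[OF p_bounds]
        using p_bounds by (intro order_trans[OF abs_triangle_ineq]) (simp add: abs_mult)
      ultimately show ?case using Cons by (simp add: algebra_simps add_divide_distrib)
    qed (simp add: slot_value_def)
    from this[of us] have "\<bar>?E None\<bar> \<le> real (length us) * (B / real m)" .
    also have "\<dots> \<le> real m * (B / real m)"
      using Cons.prems B_ge by (intro mult_right_mono) auto
    finally show ?thesis using m by simp
  qed
  then have "\<bar>p * ?E None\<bar> \<le> \<delta> * B / real m"
    using p_bounds \<delta> m by (simp add: abs_mult p_def divide_right_mono)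
  \<comment> \<open>The three terms are the error inherited from the suffix, the counter bias, and
    the loss from occupying the slot.\<close>
  moreover have "measure_pmf.expectation (slot_final None (u # us)) val - suffix_entropy m (u # us) / real m
      = (?E None - suffix_entropy m us / real m) - (D - xlogx_diff (Suc r)) / real m - p * ?E None"
    unfolding E by (simp add: r_def add_divide_distrib diff_divide_distrib)
  moreover have "real (length (u # us)) * ((6 * B * \<theta> + \<delta> * B) / real m)
     = real (length us) * ((6 * B * \<theta> + \<delta> * B) / real m) + 6 * B * \<theta> / real m + \<delta> * B / real m"
    by (simp add: algebra_simps add_divide_distrib)
  moreover have "\<bar>?E None - suffix_entropy m us / real m\<bar>
      \<le> real (length us) * ((6 * B * \<theta> + \<delta> * B) / real m)"
    using Cons by simp
  ultimately show ?case using bias by linarith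
qed (simp add: slot_value_def)

lemma ex_entropy_alg:
  assumes \<eta>: "\<eta> > 0" "6 * B * \<theta> + \<delta> * B \<le> \<eta>" and q: "q > 0" "3 * (B\<^sup>2 / \<delta>) \<le> real q * \<eta>\<^sup>2"
    and k: "(1 + n * (M + 1)) ^ q \<le> 2 ^ k"
  shows "\<exists>A. \<forall>us \<in> insertion_streams n m.
     (\<forall>\<sigma>\<in>set_pmf (run A us). state_changes \<sigma> \<le> q * (M + 1) \<and> (\<forall>s\<in>set \<sigma>. length s \<le> k)) \<and>
     measure_pmf.prob (run A us) {\<sigma>. \<bar>answer A (last \<sigma>) - shannon_entropy n us\<bar> \<le> 2 * \<eta>} \<ge> 2 / 3"
proof -
  let ?T = "prod_step q None (slot_step M (\<theta>\<^sup>2) p)"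
  let ?S = "PiE_dflt {..<q} None (\<lambda>_. slots n M)"
  let ?out = "\<lambda>f. (\<Sum>j<q. val (f j)) / real q"
  \<comment> \<open>The sum of the slot ranks serves as rank; each is at most \<open>M + 1\<close>,
    whence the bound \<open>q * (M + 1)\<close> on the state changes.\<close>
  let ?rank = "\<lambda>f. \<Sum>j<q. slot_rank (f j)"
  have step: "g j \<in> set_pmf (slot_step M (\<theta>\<^sup>2) p (f j) u)" if "g \<in> set_pmf (?T f u)" "j < q" for f g u j
    using that set_Pi_pmf_subset'[of "{..<q}" None] by (fastforce simp: prod_step_def PiE_dflt_def)
  have dflt: "g j = None" if "g \<in> set_pmf (?T f u)" "\<not> j < q" for f g u j
    using that set_Pi_pmf_subset[of "{..<q}" None] by (fastforce simp: prod_step_def)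
  have "\<exists>A. \<forall>us. set us \<subseteq> {1..n} \<longrightarrow>
     (\<forall>\<sigma>\<in>set_pmf (run A us). state_changes \<sigma> \<le> q * (M + 1) \<and> (\<forall>s\<in>set \<sigma>. length s \<le> k)) \<and>
     map_pmf (\<lambda>\<sigma>. answer A (last \<sigma>)) (run A us) = map_pmf ?out (final_state ?T (\<lambda>_. None) us)"
  proof (rule streaming_alg_of_chain[where S = ?S and rank = ?rank])
    show "finite ?S" by (intro finite_PiE_dflt card_slots) auto
    show "card ?S \<le> 2 ^ k" using k by (simp add: card_PiE_dflt card_slots)
    show "(\<lambda>_. None) \<in> ?S" by (simp add: PiE_dflt_def slots_def)
    fix f :: "nat \<Rightarrow> (nat \<times> nat) option" assume f: "f \<in> ?S"
    show "?rank f \<le> q * (M + 1)"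
      using f sum_bounded_above[of "{..<q}" "\<lambda>j. slot_rank (f j)" "M + 1"]
      by (auto simp: PiE_dflt_def dest: slot_rank_le)
    fix u g assume u: "u \<in> {1..n}" and g: "g \<in> set_pmf (?T f u)"
    have fj: "f j \<in> slots n M" if "j < q" for j using f that by (auto simp: PiE_dflt_def)
    show "g \<in> ?S"
      using slot_step_closed(1)[OF fj u step[OF g]] dflt[OF g] by (auto simp: PiE_dflt_def)
    assume "g \<noteq> f"
    then obtain j where j: "g j \<noteq> f j" by auto
    moreover have "g i = f i" if "\<not> i < q" for i
      using dflt[OF g that] f that by (auto simp: PiE_dflt_def)
    ultimately have "j < q" by auto
    \<comment> \<open>One update may move several slots at once. No slot loses rank and every moved
      slot gains some, so the sum strictly increases.\<close>
    have lt: "slot_rank (f i) < slot_rank (g i)" if "i < q" "g i \<noteq> f i" for i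
      using slot_step_closed(2)[OF fj u step[OF g]] that by auto
    have "slot_rank (f i) \<le> slot_rank (g i)" if "i < q" for i
      using lt[OF that] by (cases "g i = f i") auto
    then show "?rank f < ?rank g"
      using lt j \<open>j < q\<close> by (intro sum_strict_mono_ex1) auto
  qed
  then obtain A where A: "\<And>us. set us \<subseteq> {1..n} \<Longrightarrow>
     (\<forall>\<sigma>\<in>set_pmf (run A us). state_changes \<sigma> \<le> q * (M + 1) \<and> (\<forall>s\<in>set \<sigma>. length s \<le> k)) \<and>
     map_pmf (\<lambda>\<sigma>. answer A (last \<sigma>)) (run A us) = map_pmf ?out (final_state ?T (\<lambda>_. None) us)"
    by blast
  have "measure_pmf.prob (run A us) {\<sigma>. \<bar>answer A (last \<sigma>) - shannon_entropy n us\<bar> \<le> 2 * \<eta>} \<ge> 2 / 3"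
    if us: "us \<in> insertion_streams n m" for us
  proof -
    let ?H = "shannon_entropy n us"
    have us': "set us \<subseteq> {1..n}" "length us = m" using us by (auto simp: insertion_streams_def)
    have "measure_pmf.prob (run A us) {\<sigma>. \<bar>answer A (last \<sigma>) - ?H\<bar> \<le> 2 * \<eta>}
        = measure_pmf.prob (map_pmf (\<lambda>\<sigma>. answer A (last \<sigma>)) (run A us)) {x. \<bar>x - ?H\<bar> \<le> 2 * \<eta>}"
      by (simp add: vimage_def)
    also have "\<dots> = measure_pmf.prob (Pi_pmf {..<q} None (\<lambda>_. slot_final None us))
        {f. \<bar>?out f - ?H\<bar> \<le> 2 * \<eta>}"
      using A[OF us'(1)] by (simp add: vimage_def final_state_prod_step)
    also have "\<dots> \<ge> 2 / 3"
    proof (rule Pi_pmf_mean_concentration[OF _ q(1) \<eta>(1) _ _ q(2)])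
      show "\<bar>measure_pmf.expectation (slot_final None us) val - ?H\<bar> \<le> \<eta>"
        using slot_mean[of us] \<eta>(2) m us'(2) shannon_entropy_eq_suffix_entropy[OF us m] by simp
      show "measure_pmf.expectation (slot_final None us) (\<lambda>s. (val s)\<^sup>2) \<le> B\<^sup>2 / \<delta>"
        using slot_second_moment[of us] m us'(2) by simp
    qed simp
    finally show ?thesis .
  qed
  with A show ?thesis by (intro exI[of _ A]) (auto simp: insertion_streams_def)
qed

end

subsection \<open>Choice of parameters\<close>

text \<open>By Bernoulli's inequality every \<open>N\<close> increments at least double the power,
  so logarithmically many blocks of length \<open>N\<close> reach a given size.\<close>

lemma power_one_plus_inverse_ge:
  assumes "N > 0"
  shows "(1 + 1 / real N) ^ (N * l) \<ge> 2 ^ l"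
proof -
  have "-1 \<le> 1 / real N" by (rule order_trans[of _ 0]) auto
  then have "2 \<le> (1 + 1 / real N) ^ N"
    using Bernoulli_inequality[of "1 / real N" N] assms by simp
  then have "2 ^ l \<le> ((1 + 1 / real N) ^ N) ^ l" by (intro power_mono) auto
  then show ?thesis by (simp add: power_mult)
qed

lemma le_two_power_ceiling_log:
  assumes "x \<ge> (1::nat)"
  shows "real x \<le> 2 ^ nat \<lceil>log 2 (real x)\<rceil>"
proof -
  have "real x = 2 powr log 2 (real x)" using assms by simp
  also have "\<dots> \<le> 2 powr real (nat \<lceil>log 2 (real x)\<rceil>)"
    by (intro powr_mono) linarith+
  finally show ?thesis by (simp add: powr_realpow)
qed

lemma ex_entropy_alg_bounds:
  fixes n m :: nat and \<epsilon> :: real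
  assumes n: "n \<ge> 1" and m: "m \<ge> 1" and \<epsilon>: "0 < \<epsilon>" "\<epsilon> < 1"
  defines "B \<equiv> 2 + log 2 (real m)"
  shows "\<exists>A. \<forall>us \<in> insertion_streams n m.
     (\<forall>\<sigma>\<in>set_pmf (run A us). real (state_changes \<sigma>) \<le> 30674 * B ^ 6 / \<epsilon> ^ 5 \<and>
        (\<forall>s\<in>set \<sigma>. real (length s) \<le> 49 * B ^ 3 / \<epsilon> ^ 3 * (626 * B ^ 3 / \<epsilon>\<^sup>2 + 2 + log 2 (real n)))) \<and>
     measure_pmf.prob (run A us) {\<sigma>. \<bar>answer A (last \<sigma>) - shannon_entropy n us\<bar> \<le> \<epsilon>} \<ge> 2 / 3"
proof -
  \<comment> \<open>The budget is \<open>\<eta> = \<epsilon> / 2\<close>: this choice gives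
    \<open>\<delta> B = \<epsilon> / 4\<close>, and \<open>\<theta> = 1 / g\<close> below gives
    \<open>6 B \<theta> \<le> \<epsilon> / 4\<close>.\<close>
  define \<delta> where "\<delta> = \<epsilon> / (4 * B)"
  define g where "g = nat \<lceil>24 * B / \<epsilon>\<rceil>"
  define l where "l = nat \<lceil>log 2 (real m)\<rceil>"
  \<comment> \<open>Since \<open>a = 1 / g^2\<close>, each block of \<open>g^2\<close> increments
    doubles \<open>(1 + a)^k\<close>, and \<open>l\<close> doublings reach \<open>m\<close>.\<close>
  define M where "M = g\<^sup>2 * l"
  \<comment> \<open>Concentration needs \<open>3 (B^2 / \<delta>) / \<eta>^2\<close> copies, which
    is \<open>48 B^3 / \<epsilon>^3\<close>.\<close>
  define q where "q = nat \<lceil>48 * B ^ 3 / \<epsilon> ^ 3\<rceil>"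
  define k where "k = q * (nat \<lceil>log 2 (real n)\<rceil> + (M + 1))"
  have B: "B \<ge> 2" using m by (simp add: B_def)
  \<comment> \<open>This absorbs the additive ones from rounding up: \<open>24\<close> becomes
    \<open>25\<close>, \<open>48\<close> becomes \<open>49\<close>, and \<open>25^2\<close> becomes
    \<open>626\<close>. The product \<open>49 * 626\<close> is \<open>30674\<close>.\<close>
  have ge1: "1 \<le> B ^ i / \<epsilon> ^ j" for i j
  proof -
    have "\<epsilon> ^ j \<le> 1" using \<epsilon> by (intro power_le_one) auto
    moreover have "1 \<le> B ^ i" using B by (intro one_le_power) auto
    ultimately have "\<epsilon> ^ j \<le> B ^ i" by linarith
    then show ?thesis using \<epsilon> by simp
  qed
  have g: "24 * B / \<epsilon> \<le> real g" "real g \<le> 25 * (B / \<epsilon>)"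
    using ge1[of 1 1] unfolding g_def power_one_right by linarith+
  have q: "48 * B ^ 3 / \<epsilon> ^ 3 \<le> real q" "real q \<le> 49 * (B ^ 3 / \<epsilon> ^ 3)"
    using ge1[of 3 3] unfolding q_def by linarith+
  have "real g \<ge> 24" "real q \<ge> 48"
    using g(1) q(1) ge1[of 1 1] ge1[of 3 3] unfolding power_one_right by linarith+
  then have g0: "g > 0" and q0: "q > 0" by auto
  have "0 \<le> log 2 (real m)" using m by simp
  then have l: "real l \<le> B" unfolding l_def B_def by linarith
  have "real M \<le> (25 * (B / \<epsilon>))\<^sup>2 * B"
    using g(2) l unfolding M_def of_nat_mult of_nat_power by (intro mult_mono power_mono) auto
  then have M: "real (M + 1) \<le> 626 * (B ^ 3 / \<epsilon> ^ 2)"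
    using ge1[of 3 2] by (simp add: power_divide power2_eq_square power3_eq_cube)
  interpret slot: slot_chain m M \<delta> "1 / real g"
  proof
    show "0 < \<delta>" "\<delta> \<le> 1" using \<epsilon> B by (auto simp: \<delta>_def field_simps)
    have "real m \<le> 2 ^ l" unfolding l_def by (rule le_two_power_ceiling_log[OF m])
    also have "\<dots> \<le> (1 + 1 / real (g\<^sup>2)) ^ (g\<^sup>2 * l)"
      using g0 by (intro power_one_plus_inverse_ge) auto
    finally have m_le: "real m \<le> (1 + (1 / real g)\<^sup>2) ^ M"
      by (simp add: M_def power_divide)
    \<comment> \<open>As \<open>a \<le> 1\<close>, dividing by \<open>a\<close> only enlarges, so
      the estimate at \<open>M\<close> is at least \<open>(1 + a)^M\<close>.\<close>
    have "(1 / real g)\<^sup>2 \<le> 1" using g0 by (simp add: power_divide)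
    moreover have "0 \<le> (1 + (1 / real g)\<^sup>2) ^ M - 1" by simp
    ultimately have "(1 + (1 / real g)\<^sup>2) ^ M - 1 \<le> ((1 + (1 / real g)\<^sup>2) ^ M - 1) / (1 / real g)\<^sup>2"
      using g0 by (subst pos_le_divide_eq) (auto intro: mult_left_le)
    then show "real m \<le> morris_estimate ((1 / real g)\<^sup>2) M"
      using m_le by (simp add: morris_estimate_def)
  qed (use m g0 in auto)
  have B_eq: "slot.B = B" by (simp add: B_def slot.B_def)
  have ex: "\<exists>A. \<forall>us \<in> insertion_streams n m.
     (\<forall>\<sigma>\<in>set_pmf (run A us). state_changes \<sigma> \<le> q * (M + 1) \<and> (\<forall>s\<in>set \<sigma>. length s \<le> k)) \<and>
     measure_pmf.prob (run A us) {\<sigma>. \<bar>answer A (last \<sigma>) - shannon_entropy n us\<bar> \<le> 2 * (\<epsilon> / 2)} \<ge> 2 / 3"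
  proof (rule slot.ex_entropy_alg[unfolded B_eq])
    have "6 * B * (1 / real g) \<le> \<epsilon> / 4" using g(1) g0 \<epsilon> by (simp add: field_simps)
    moreover have "\<delta> * B = \<epsilon> / 4" using B by (simp add: \<delta>_def)
    ultimately show "6 * B * (1 / real g) + \<delta> * B \<le> \<epsilon> / 2" by simp
    have "48 * B ^ 3 / \<epsilon> ^ 3 * (\<epsilon> / 2)\<^sup>2 \<le> real q * (\<epsilon> / 2)\<^sup>2"
      using q(1) by (intro mult_right_mono) auto
    moreover have "48 * B ^ 3 / \<epsilon> ^ 3 * (\<epsilon> / 2)\<^sup>2 = 3 * (B\<^sup>2 / \<delta>)"
      using \<epsilon> B by (simp add: \<delta>_def field_simps power2_eq_square power3_eq_cube)
    ultimately show "3 * (B\<^sup>2 / \<delta>) \<le> real q * (\<epsilon> / 2)\<^sup>2" by simp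
    have "1 + n * (M + 1) \<le> n * (M + 2)" using n by (simp add: algebra_simps)
    also have "\<dots> \<le> 2 ^ nat \<lceil>log 2 (real n)\<rceil> * 2 ^ (M + 1)"
    proof (rule mult_mono)
      show "n \<le> 2 ^ nat \<lceil>log 2 (real n)\<rceil>"
        using le_two_power_ceiling_log[OF n] by (metis of_nat_le_iff of_nat_numeral of_nat_power)
      show "M + 2 \<le> 2 ^ (M + 1)" using less_exp[of "M + 1"] by simp
    qed auto
    also have "\<dots> = 2 ^ (nat \<lceil>log 2 (real n)\<rceil> + (M + 1))" by (simp add: power_add)
    finally have "(1 + n * (M + 1)) ^ q \<le> (2 ^ (nat \<lceil>log 2 (real n)\<rceil> + (M + 1))) ^ q"
      by (intro power_mono) auto
    also have "\<dots> = 2 ^ k" unfolding k_def power_mult[symmetric] by (simp only: mult.commute)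
    finally show "(1 + n * (M + 1)) ^ q \<le> 2 ^ k" .
  qed (use \<epsilon> q0 in auto)
  have changes: "real (q * (M + 1)) \<le> 30674 * B ^ 6 / \<epsilon> ^ 5"
  proof -
    have "real (q * (M + 1)) \<le> (49 * (B ^ 3 / \<epsilon> ^ 3)) * (626 * (B ^ 3 / \<epsilon> ^ 2))"
      unfolding of_nat_mult using q M by (intro mult_mono) auto
    also have "\<dots> = 30674 * (B ^ (3 + 3) / \<epsilon> ^ (3 + 2))" unfolding power_add by simp
    finally show ?thesis by simp
  qed
  have space: "real k \<le> 49 * B ^ 3 / \<epsilon> ^ 3 * (626 * B ^ 3 / \<epsilon>\<^sup>2 + 2 + log 2 (real n))"
  proof -
    have "0 \<le> log 2 (real n)" using n by simp
    then have "real (nat \<lceil>log 2 (real n)\<rceil>) \<le> log 2 (real n) + 1" by linarith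
    then have "real (nat \<lceil>log 2 (real n)\<rceil> + (M + 1)) \<le> 626 * B ^ 3 / \<epsilon>\<^sup>2 + 2 + log 2 (real n)"
      using M by simp
    then show ?thesis
      unfolding k_def of_nat_mult using q by (intro mult_mono) auto
  qed
  from ex obtain A where A: "\<And>us. us \<in> insertion_streams n m \<Longrightarrow>
     (\<forall>\<sigma>\<in>set_pmf (run A us). state_changes \<sigma> \<le> q * (M + 1) \<and> (\<forall>s\<in>set \<sigma>. length s \<le> k)) \<and>
     measure_pmf.prob (run A us) {\<sigma>. \<bar>answer A (last \<sigma>) - shannon_entropy n us\<bar> \<le> \<epsilon>} \<ge> 2 / 3"
    by auto
  show ?thesis
    using A order_trans[OF of_nat_mono changes] order_trans[OF of_nat_mono space]
    by (intro exI[of _ A]) blast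
qed

section \<open>The universe with a single item\<close>

lemma shannon_entropy_one:
  assumes "us \<in> insertion_streams 1 m" "m \<ge> 1"
  shows "shannon_entropy 1 us = 0"
proof -
  have us: "length us = m" "set us \<subseteq> {1}" using assms by (auto simp: insertion_streams_def)
  then have "{t. t < length us \<and> us ! t = 1} = {..<m}"
    using nth_mem by fastforce
  then show ?thesis using assms us by (simp add: shannon_entropy_def frequency_def)
qed

text \<open>For \<open>n = 1\<close> the factor \<open>log 2 n\<close> vanishes, so a bound with a
  positive power of it permits no state change. One state suffices, since the entropy is
  \<open>0\<close>.\<close>

lemma ex_trivial_alg:
  assumes "m \<ge> 1"
  shows "\<exists>A. \<forall>us \<in> insertion_streams 1 m.
     (\<forall>\<sigma>\<in>set_pmf (run A us). state_changes \<sigma> = 0 \<and> (\<forall>s\<in>set \<sigma>. s = [])) \<and>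
     map_pmf (\<lambda>\<sigma>. answer A (last \<sigma>)) (run A us) = return_pmf (shannon_entropy 1 us)"
proof -
  have "\<exists>A. \<forall>us. set us \<subseteq> UNIV \<longrightarrow>
     (\<forall>\<sigma>\<in>set_pmf (run A us). state_changes \<sigma> \<le> 0 \<and> (\<forall>s\<in>set \<sigma>. length s \<le> 0)) \<and>
     map_pmf (\<lambda>\<sigma>. answer A (last \<sigma>)) (run A us)
       = map_pmf (\<lambda>_. 0) (final_state (\<lambda>_ _. return_pmf ()) () us)"
    by (rule streaming_alg_of_chain[where S = UNIV and rank = "\<lambda>_. 0"]) auto
  then obtain A where "\<And>us. (\<forall>\<sigma>\<in>set_pmf (run A us). state_changes \<sigma> = 0 \<and> (\<forall>s\<in>set \<sigma>. s = []))
     \<and> map_pmf (\<lambda>\<sigma>. answer A (last \<sigma>)) (run A us) = return_pmf 0"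
    by auto
  then show ?thesis using shannon_entropy_one[OF _ assms] by (intro exI[of _ A]) simp
qed

theorem theorem3p8:
  fixes K c :: nat
  shows "\<exists>(C::real) (a::nat) (b::nat) (d::nat) (e::nat).
    \<forall>(n::nat) (m::nat) (\<epsilon>::real).
      1 \<le> n \<and> 1 \<le> m \<and> m \<le> K * n ^ c \<and> 0 < \<epsilon> \<and> \<epsilon> < 1 \<longrightarrow>
      (\<exists>A::streaming_alg. \<forall>us \<in> insertion_streams n m.
         (\<forall>\<sigma> \<in> set_pmf (run A us).
            real (state_changes \<sigma>) \<le> C * (1 / \<epsilon> ^ a) * sqrt (real n) * log 2 (real n) ^ b) \<and>
         (\<forall>\<sigma> \<in> set_pmf (run A us). \<forall>s \<in> set \<sigma>.
            real (length s) \<le> C * (log 2 (real m * real n) ^ d / \<epsilon> ^ e)) \<and>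
         measure_pmf.prob (run A us)
           {\<sigma>. \<bar>answer A (last \<sigma>) - shannon_entropy n us\<bar> \<le> \<epsilon>} \<ge> 2 / 3)"
proof -
  \<comment> \<open>The first summand serves the state changes, the second the space. There
    \<open>27 = 3^3\<close> comes from \<open>B \<le> 3 L\<close>, and
    \<open>16905 = 626 * 27 + 3\<close> bounds the bits per slot.\<close>
  define C :: real where "C = 30674 * (2 + real K + real c) ^ 6 + 49 * 27 * 16905"
  have C: "30674 * (2 + real K + real c) ^ 6 \<le> C" "49 * 27 * 16905 \<le> C" "0 \<le> C"
    by (auto simp: C_def)
  have "\<exists>A::streaming_alg. \<forall>us \<in> insertion_streams n m.
         (\<forall>\<sigma> \<in> set_pmf (run A us).
            real (state_changes \<sigma>) \<le> C * (1 / \<epsilon> ^ 5) * sqrt (real n) * log 2 (real n) ^ 6) \<and>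
         (\<forall>\<sigma> \<in> set_pmf (run A us). \<forall>s \<in> set \<sigma>.
            real (length s) \<le> C * (log 2 (real m * real n) ^ 6 / \<epsilon> ^ 5)) \<and>
         measure_pmf.prob (run A us)
           {\<sigma>. \<bar>answer A (last \<sigma>) - shannon_entropy n us\<bar> \<le> \<epsilon>} \<ge> 2 / 3"
    if n: "1 \<le> n" and m: "1 \<le> m" "m \<le> K * n ^ c" and \<epsilon>: "0 < \<epsilon>" "\<epsilon> < 1" for n m \<epsilon>
  proof (cases "n = 1")
    case True
    obtain A where A: "\<And>us. us \<in> insertion_streams 1 m \<Longrightarrow>
       (\<forall>\<sigma>\<in>set_pmf (run A us). state_changes \<sigma> = 0 \<and> (\<forall>s\<in>set \<sigma>. s = [])) \<and>
       map_pmf (\<lambda>\<sigma>. answer A (last \<sigma>)) (run A us) = return_pmf (shannon_entropy 1 us)"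
      using ex_trivial_alg[OF m(1)] by blast
    have "measure_pmf.prob (run A us) {\<sigma>. \<bar>answer A (last \<sigma>) - shannon_entropy 1 us\<bar> \<le> \<epsilon>} = 1"
      if us: "us \<in> insertion_streams 1 m" for us
    proof -
      have "measure_pmf.prob (run A us) {\<sigma>. \<bar>answer A (last \<sigma>) - shannon_entropy 1 us\<bar> \<le> \<epsilon>}
        = measure_pmf.prob (map_pmf (\<lambda>\<sigma>. answer A (last \<sigma>)) (run A us)) {x. \<bar>x - shannon_entropy 1 us\<bar> \<le> \<epsilon>}"
        by (simp add: vimage_def)
      then show ?thesis using A[OF us] \<epsilon> by simp
    qed
    moreover have "0 \<le> C * (log 2 (real m * real n) ^ 6 / \<epsilon> ^ 5)"
      using C True m \<epsilon> by simp
    ultimately show ?thesis using A C(3) True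
      by (intro exI[of _ A] ballI conjI) (fastforce, fastforce, simp)
  next
    case False
    with n have n2: "n \<ge> 2" by simp
    define B where "B = 2 + log 2 (real m)"
    define N where "N = log 2 (real n)"
    define L where "L = log 2 (real m * real n)"
    \<comment> \<open>From \<open>n \<ge> 2\<close> on, additive constants can be absorbed into
      multiples of \<open>N\<close> and \<open>L\<close>.\<close>
    have N: "N \<ge> 1" using n2 by (simp add: N_def)
    have L_eq: "L = log 2 (real m) + N" using m n by (simp add: L_def N_def log_mult)
    have lm: "0 \<le> log 2 (real m)" using m by simp
    have B0: "0 \<le> B" using lm by (simp add: B_def)
    have BL: "B \<le> 3 * L" using N lm by (simp add: B_def L_eq)
    \<comment> \<open>Here the polynomial bound on \<open>m\<close> enters:
      \<open>log m \<le> log K + c N\<close>, where \<open>log K \<le> K\<close> because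
      \<open>K < 2 ^ K\<close>.\<close>
    have BN: "B \<le> (2 + real K + real c) * N"
    proof -
      have K: "K \<ge> 1" using m by (cases K) auto
      have "real m \<le> real K * real n ^ c" using m(2) by (metis of_nat_le_iff of_nat_mult of_nat_power)
      then have "log 2 (real m) \<le> log 2 (real K * real n ^ c)" using m by simp
      also have "\<dots> = log 2 (real K) + real c * N"
        using K n by (simp add: log_mult log_nat_power N_def)
      also have "log 2 (real K) \<le> real K"
        using K less_exp[of K] by (intro log2_of_power_le) auto
      also have "real K \<le> real K * N" using N by (simp add: mult_le_cancel_left1)
      finally show ?thesis using N by (simp add: B_def algebra_simps)
    qed
    obtain A where A: "\<And>us. us \<in> insertion_streams n m \<Longrightarrow>
       (\<forall>\<sigma>\<in>set_pmf (run A us). real (state_changes \<sigma>) \<le> 30674 * B ^ 6 / \<epsilon> ^ 5 \<and>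
        (\<forall>s\<in>set \<sigma>. real (length s) \<le> 49 * B ^ 3 / \<epsilon> ^ 3 * (626 * B ^ 3 / \<epsilon>\<^sup>2 + 2 + N))) \<and>
       measure_pmf.prob (run A us) {\<sigma>. \<bar>answer A (last \<sigma>) - shannon_entropy n us\<bar> \<le> \<epsilon>} \<ge> 2 / 3"
      using ex_entropy_alg_bounds[OF n m(1) \<epsilon>] unfolding B_def N_def by blast
    have changes: "30674 * B ^ 6 / \<epsilon> ^ 5 \<le> C * (1 / \<epsilon> ^ 5) * sqrt (real n) * N ^ 6"
    proof -
      have "30674 * B ^ 6 \<le> 30674 * ((2 + real K + real c) * N) ^ 6"
        using BN B0 by (intro mult_left_mono power_mono) auto
      \<comment> \<open>The factor \<open>1\<close> is the placeholder that
        \<open>sqrt n \<ge> 1\<close> replaces in the next line; the polylogarithmic bound is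
        stronger than the required one.\<close>
      also have "\<dots> = (30674 * (2 + real K + real c) ^ 6) * 1 * N ^ 6" by (simp add: power_mult_distrib)
      also have "\<dots> \<le> C * sqrt (real n) * N ^ 6"
        using C n N by (intro mult_mono) auto
      finally have "30674 * B ^ 6 / \<epsilon> ^ 5 \<le> C * sqrt (real n) * N ^ 6 / \<epsilon> ^ 5"
        using \<epsilon> by (intro divide_right_mono) auto
      then show ?thesis by simp
    qed
    have space: "49 * B ^ 3 / \<epsilon> ^ 3 * (626 * B ^ 3 / \<epsilon>\<^sup>2 + 2 + N) \<le> C * (L ^ 6 / \<epsilon> ^ 5)"
    proof -
      have L1: "L \<ge> 1" using N lm by (simp add: L_eq)
      have B3: "B ^ 3 \<le> 27 * L ^ 3"
        using power_mono[OF BL B0, of 3] by (simp add: power_mult_distrib)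
      have "2 + N \<le> 3 * (L ^ 3 / \<epsilon>\<^sup>2)"
      proof -
        have "2 + N \<le> 3 * L" using N lm by (simp add: L_eq)
        also have "L \<le> L ^ 3" using L1 power_increasing[of 1 3 L] by simp
        also have "L ^ 3 \<le> L ^ 3 / \<epsilon>\<^sup>2"
          using \<epsilon> L1 by (simp add: le_divide_eq mult_left_le power_le_one)
        finally show ?thesis by simp
      qed
      moreover have "626 * B ^ 3 / \<epsilon>\<^sup>2 \<le> 16902 * (L ^ 3 / \<epsilon>\<^sup>2)"
        using B3 \<epsilon> by (simp add: field_simps)
      ultimately have "626 * B ^ 3 / \<epsilon>\<^sup>2 + 2 + N \<le> 16905 * (L ^ 3 / \<epsilon>\<^sup>2)" by linarith
      moreover have "49 * B ^ 3 / \<epsilon> ^ 3 \<le> 49 * 27 * (L ^ 3 / \<epsilon> ^ 3)"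
        using B3 \<epsilon> by (simp add: field_simps)
      ultimately have "49 * B ^ 3 / \<epsilon> ^ 3 * (626 * B ^ 3 / \<epsilon>\<^sup>2 + 2 + N)
          \<le> 49 * 27 * (L ^ 3 / \<epsilon> ^ 3) * (16905 * (L ^ 3 / \<epsilon>\<^sup>2))"
        using B0 N \<epsilon> L1 by (intro mult_mono) auto
      also have "\<dots> = 49 * 27 * 16905 * (L ^ (3 + 3) / \<epsilon> ^ (3 + 2))" unfolding power_add by simp
      also have "\<dots> \<le> C * (L ^ (3 + 3) / \<epsilon> ^ (3 + 2))"
        using C \<epsilon> L1 by (intro mult_right_mono) auto
      finally show ?thesis by simp
    qed
    show ?thesis
      using A order_trans[OF _ changes] order_trans[OF _ space]
      unfolding N_def[symmetric] L_def[symmetric] by (intro exI[of _ A]) blast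
  qed
  then show ?thesis by blast
qed

end
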